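(* Let $\alpha,\beta>-1$ and $\sigma>-1$. Put $\rho=\frac{\alpha+\beta+1}{2}$, $\delta=\rho-\sigma$, $A=\frac{1-4\alpha^2}{16}$, $B=\frac{1-4\beta^2}{16}$, and for $h>0$ and $0<t<h\pi$ define \[ Q_h(t)=\left(1+\frac{\delta}{h}\right)^2+\frac{A}{h^2\sin^2(t/2h)}+\frac{B}{h^2\cos^2(t/2h)}. \] Then the following assertions hold. (1) If $|\beta|>1/2$, the inequality $\frac{\partial Q_h(t)}{\partial h}\leq0$ cannot hold for every $h\geq1+\sigma$ and $0<t<h\pi$. If $|\beta|\leq1/2$, it holds throughout that domain if and only if $\sigma\leq\sigma_\uparrow(\alpha,\beta)$. (2) If $|\beta|<1/2$, the inequality $\frac{\partial Q_h(t)}{\partial h}\geq0$ cannot hold for every $h\geq1+\sigma$ and $0<t<h\pi$. If $|\beta|\geq1/2$, it holds throughout that domain if and only if $\sigma\geq\sigma_\downarrow(\alpha,\beta)$. In either case, for each fixed $t>0$, the function $h\mapsto Q_h(t)$ is constant on a nondegenerate interval of its admissible domain (values of $h>0$ with $t<h\pi$) if and only if $A=B=0$ and $\sigma=\rho$.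
   Context: Here $t/2h$ means $t/(2h)$ and $s_+=\max\{s,0\}$. Put \[ \Phi_{\alpha,\beta}(x)=A\,\frac{1-x\cot x}{\sin^2x}+B\,\frac{1+x\tan x}{\cos^2x},\qquad 0<x<\frac{\pi}{2}. \] For $|\beta|\le 1/2$, $m_{\alpha,\beta}=\inf_{0<x<\pi/2}\Phi_{\alpha,\beta}(x)$ (which is finite) and $\sigma_\uparrow(\alpha,\beta)=\rho-\frac{(-m_{\alpha,\beta})_+}{1+\rho}$. For $|\beta|\ge1/2$, $M_{\alpha,\beta}=\sup_{0<x<\pi/2}\Phi_{\alpha,\beta}(x)$ (which is finite) and $\sigma_\downarrow(\alpha,\beta)=\rho+\frac{(M_{\alpha,\beta})_+}{1+\rho}$. *)

theory Defs
  imports "HOL-Analysis.Analysis"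
begin

definition rho :: "real \<Rightarrow> real \<Rightarrow> real" where
  "rho \<alpha> \<beta> = (\<alpha> + \<beta> + 1) / 2"

definition delta :: "real \<Rightarrow> real \<Rightarrow> real \<Rightarrow> real" where
  "delta \<alpha> \<beta> \<sigma> = rho \<alpha> \<beta> - \<sigma>"

definition coeffA :: "real \<Rightarrow> real" where
  "coeffA \<alpha> = (1 - 4 * \<alpha>\<^sup>2) / 16"

definition coeffB :: "real \<Rightarrow> real" where
  "coeffB \<beta> = (1 - 4 * \<beta>\<^sup>2) / 16"

definition Q :: "real \<Rightarrow> real \<Rightarrow> real \<Rightarrow> real \<Rightarrow> real \<Rightarrow> real" where
  "Q \<alpha> \<beta> \<sigma> h t =
     (1 + delta \<alpha> \<beta> \<sigma> / h)\<^sup>2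
     + coeffA \<alpha> / (h\<^sup>2 * (sin (t / (2 * h)))\<^sup>2)
     + coeffB \<beta> / (h\<^sup>2 * (cos (t / (2 * h)))\<^sup>2)"

definition \<Phi> :: "real \<Rightarrow> real \<Rightarrow> real \<Rightarrow> real" where
  "\<Phi> \<alpha> \<beta> x =
     coeffA \<alpha> * ((1 - x * cot x) / (sin x)\<^sup>2)
     + coeffB \<beta> * ((1 + x * tan x) / (cos x)\<^sup>2)"

text \<open>
  The infimum \<open>\<Phi>_inf\<close> is meaningful for \<open>\<bar>\<beta>\<bar> \<le> 1/2\<close> and the supremum
  \<open>\<Phi>_sup\<close> for \<open>\<bar>\<beta>\<bar> \<ge> 1/2\<close>; the lemmas at the end of this theory show that
  they are finite in these ranges. Outside them the real-valued \<open>Inf\<close> and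
  \<open>Sup\<close> carry no information.
\<close>

definition \<Phi>_inf :: "real \<Rightarrow> real \<Rightarrow> real" where
  "\<Phi>_inf \<alpha> \<beta> = (INF x\<in>{0<..<pi/2}. \<Phi> \<alpha> \<beta> x)"

definition \<Phi>_sup :: "real \<Rightarrow> real \<Rightarrow> real" where
  "\<Phi>_sup \<alpha> \<beta> = (SUP x\<in>{0<..<pi/2}. \<Phi> \<alpha> \<beta> x)"

definition sigma_up :: "real \<Rightarrow> real \<Rightarrow> real" where
  "sigma_up \<alpha> \<beta> = rho \<alpha> \<beta> - max (- \<Phi>_inf \<alpha> \<beta>) 0 / (1 + rho \<alpha> \<beta>)"

definition sigma_down :: "real \<Rightarrow> real \<Rightarrow> real" where
  "sigma_down \<alpha> \<beta> = rho \<alpha> \<beta> + max (\<Phi>_sup \<alpha> \<beta>) 0 / (1 + rho \<alpha> \<beta>)"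

lemma cot_term_bounds:
  fixes x :: real
  assumes "0 < x" "x < pi/2"
  shows "\<bar>(1 - x * cot x) / (sin x)\<^sup>2\<bar> \<le> pi\<^sup>2 / 4"
proof -
  have s: "sin x > 0" using assms by (intro sin_gt_zero) auto
  have lo: "0 \<le> sin x - x * cos x"
  proof -
    have "sin 0 - 0 * cos 0 \<le> sin x - x * cos x"
    proof (rule DERIV_nonneg_imp_nondecreasing[of 0 x])
      fix y assume "0 \<le> y" "y \<le> x"
      moreover from this have "0 \<le> y * sin y"
        using assms by (intro mult_nonneg_nonneg sin_ge_zero) auto
      moreover have "((\<lambda>y. sin y - y * cos y) has_real_derivative y * sin y) (at y)"
        by (auto intro!: derivative_eq_intros)
      ultimately show "\<exists>d. ((\<lambda>y. sin y - y * cos y) has_real_derivative d) (at y) \<and> 0 \<le> d"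
        by blast
    qed (use assms in simp)
    then show ?thesis by simp
  qed
  have hi: "sin x - x * cos x \<le> x\<^sup>2 * sin x"
  proof -
    have "0\<^sup>2 * sin 0 - (sin 0 - 0 * cos 0) \<le> x\<^sup>2 * sin x - (sin x - x * cos x)"
    proof (rule DERIV_nonneg_imp_nondecreasing[of 0 x])
      fix y assume y: "0 \<le> y" "y \<le> x"
      have "0 \<le> y * sin y + y\<^sup>2 * cos y"
        using assms y by (intro add_nonneg_nonneg mult_nonneg_nonneg sin_ge_zero cos_ge_zero) auto
      moreover have "((\<lambda>y. y\<^sup>2 * sin y - (sin y - y * cos y)) has_real_derivative
          y * sin y + y\<^sup>2 * cos y) (at y)"
        by (auto intro!: derivative_eq_intros simp: algebra_simps)
      ultimately show "\<exists>d. ((\<lambda>y. y\<^sup>2 * sin y - (sin y - y * cos y)) has_real_derivative d) (at y) \<and> 0 \<le> d"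
        by blast
    qed (use assms in simp)
    then show ?thesis by simp
  qed
  have jordan: "x \<le> pi / 2 * sin x"
  proof -
    have "concave_on {0..pi/2} sin"
      unfolding concave_on_def
    proof (rule f''_ge0_imp_convex[where f' = "\<lambda>x. - cos x" and f'' = sin])
      fix y :: real assume "y \<in> {0..pi/2}"
      then show "0 \<le> sin y" by (intro sin_ge_zero) auto
    qed (auto intro!: derivative_eq_intros)
    then have "(1 - 2*x/pi) * sin 0 + (2*x/pi) * sin (pi/2)
        \<le> sin ((1 - 2*x/pi) *\<^sub>R 0 + (2*x/pi) *\<^sub>R (pi/2))"
      using assms by (intro concave_onD) (auto simp: field_simps)
    then show ?thesis by (simp add: field_simps)
  qed
  have eq: "(1 - x * cot x) / (sin x)\<^sup>2 = (sin x - x * cos x) / (sin x)^3"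
    using s by (simp add: cot_def field_simps power2_eq_square power3_eq_cube)
  have "x\<^sup>2 \<le> (pi / 2 * sin x)\<^sup>2"
    using jordan assms by (intro power_mono) auto
  then have "x\<^sup>2 * sin x \<le> (pi\<^sup>2 / 4) * (sin x)^3"
    using mult_right_mono[of "x\<^sup>2" "(pi / 2 * sin x)\<^sup>2" "sin x"] s
    by (simp add: power2_eq_square power3_eq_cube)
  with hi have "sin x - x * cos x \<le> (pi\<^sup>2 / 4) * (sin x)^3" by linarith
  then show ?thesis
    unfolding eq using lo s by (simp add: pos_divide_le_eq)
qed

lemma tan_term_nonneg:
  fixes x :: real
  assumes "0 < x" "x < pi/2"
  shows "0 \<le> (1 + x * tan x) / (cos x)\<^sup>2"
  using assms tan_gt_zero[of x] by simp

lemma coeffB_nonneg_iff: "0 \<le> coeffB \<beta> \<longleftrightarrow> \<bar>\<beta>\<bar> \<le> 1/2"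
  using abs_le_square_iff[of \<beta> "1/2"] by (simp add: coeffB_def power_divide mult.commute)

lemma coeffB_nonpos_iff: "coeffB \<beta> \<le> 0 \<longleftrightarrow> \<bar>\<beta>\<bar> \<ge> 1/2"
  using abs_le_square_iff[of "1/2" \<beta>] by (simp add: coeffB_def power_divide mult.commute)

lemma coeffA_term_bound:
  assumes "0 < x" "x < pi/2"
  shows "\<bar>coeffA \<alpha> * ((1 - x * cot x) / (sin x)\<^sup>2)\<bar> \<le> \<bar>coeffA \<alpha>\<bar> * (pi\<^sup>2 / 4)"
  unfolding abs_mult by (rule mult_left_mono[OF cot_term_bounds[OF assms]]) simp

lemma bdd_below_\<Phi>:
  assumes "\<bar>\<beta>\<bar> \<le> 1/2"
  shows "bdd_below (\<Phi> \<alpha> \<beta> ` {0<..<pi/2})"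
proof (rule bdd_belowI2)
  fix x assume "x \<in> {0<..<pi/2}"
  then have x: "0 < x" "x < pi/2" by auto
  have "0 \<le> coeffB \<beta> * ((1 + x * tan x) / (cos x)\<^sup>2)"
    using assms tan_term_nonneg[OF x] coeffB_nonneg_iff by (intro mult_nonneg_nonneg) auto
  then show "- (\<bar>coeffA \<alpha>\<bar> * (pi\<^sup>2 / 4)) \<le> \<Phi> \<alpha> \<beta> x"
    unfolding \<Phi>_def using abs_le_D2[OF coeffA_term_bound[OF x, of \<alpha>]]
    by (smt (verit))
qed

lemma bdd_above_\<Phi>:
  assumes "\<bar>\<beta>\<bar> \<ge> 1/2"
  shows "bdd_above (\<Phi> \<alpha> \<beta> ` {0<..<pi/2})"
proof (rule bdd_aboveI2)
  fix x assume "x \<in> {0<..<pi/2}"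
  then have x: "0 < x" "x < pi/2" by auto
  have "coeffB \<beta> * ((1 + x * tan x) / (cos x)\<^sup>2) \<le> 0"
    using assms tan_term_nonneg[OF x] coeffB_nonpos_iff by (intro mult_nonpos_nonneg) auto
  then show "\<Phi> \<alpha> \<beta> x \<le> \<bar>coeffA \<alpha>\<bar> * (pi\<^sup>2 / 4)"
    unfolding \<Phi>_def using abs_le_D1[OF coeffA_term_bound[OF x, of \<alpha>]]
    by (smt (verit))
qed

end

theory Submission
  imports Defs "HOL-Complex_Analysis.Complex_Analysis"
begin

text \<open>
  In the variable \<open>x = t / 2h\<close>, which ranges over \<open>(0, \<pi>/2)\<close> independently of \<open>h\<close>, the
  derivative factorises as
  \<open>\<partial>Q/\<partial>h = -(2/h\<^sup>3) (\<delta> (h + \<delta>) + \<Phi> x)\<close>.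
  The sign of the derivative is therefore governed by an expression that is affine in \<open>h\<close> plus a
  function of \<open>x\<close> alone. It keeps a sign on the half-line \<open>h \<ge> 1 + \<sigma>\<close> exactly when the slope
  \<open>\<delta>\<close> has that sign and the inequality holds at the endpoint, where
  \<open>h + \<delta> = 1 + \<rho> > 0\<close>, against the worst value of \<open>\<Phi>\<close>
  (\<open>affine_plus_nonneg_iff\<close> and its mirror image). Solving for \<open>\<sigma>\<close> gives the two thresholds.
  If \<open>B\<close> has the wrong sign, the worst value is infinite, because \<open>1 / cos\<^sup>2 x\<close>
  blows up at \<open>\<pi>/2\<close> while the \<open>A\<close>-term stays bounded.

  The constancy statement follows by analytic continuation. If \<open>Q\<close> equals \<open>C\<close> on an interval of
  \<open>h\<close>, then clearing the denominators \<open>sin\<^sup>2 x\<close> and \<open>cos\<^sup>2 x\<close> yields an entire function of \<open>x\<close>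
  that vanishes on an interval, hence everywhere (\<open>entire_zero_on_interval\<close>). Its values at
  \<open>\<pi>/2\<close> and \<open>\<pi>\<close>, outside the original domain, isolate \<open>B\<close> and \<open>A\<close>. What is left says
  that \<open>(1 + 2\<delta>x/t)\<^sup>2\<close> takes the same value at two opposite points, which forces \<open>\<delta> = 0\<close>.
\<close>

section \<open>The derivative with respect to the scale\<close>

lemma Q_has_derivative:
  assumes h: "h > 0" and t: "0 < t" "t < h * pi"
  shows "((\<lambda>h. Q \<alpha> \<beta> \<sigma> h t) has_real_derivative
           - (2 / h ^ 3) * (delta \<alpha> \<beta> \<sigma> * (h + delta \<alpha> \<beta> \<sigma>) + \<Phi> \<alpha> \<beta> (t / (2 * h)))) (at h)"
proof -
  define x where "x = t / (2 * h)"
  have x: "0 < x" "x < pi / 2"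
    using h t by (auto simp: x_def field_simps)
  have s: "sin x > 0" using x by (intro sin_gt_zero) auto
  have c: "cos x > 0" using x by (intro cos_gt_zero) auto
  let ?d = "delta \<alpha> \<beta> \<sigma>"
  have dx: "((\<lambda>h. t / (2 * h)) has_real_derivative - x / h) (at h)"
    using h by (auto intro!: derivative_eq_intros simp: x_def field_simps power2_eq_square)
  \<comment> \<open>Each singular term is a multiple of \<open>1 / u\<^sup>2\<close> with \<open>u = h sin x\<close> or \<open>u = h cos x\<close>;
      differentiating \<open>u\<close> first produces the numerators of \<open>\<Phi>\<close>.\<close>
  have ds: "((\<lambda>h. h * sin (t / (2 * h))) has_real_derivative sin x - x * cos x) (at h)"
    using h by (auto intro!: derivative_eq_intros dx simp: x_def field_simps)
  have dc: "((\<lambda>h. h * cos (t / (2 * h))) has_real_derivative cos x + x * sin x) (at h)"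
    using h by (auto intro!: derivative_eq_intros dx simp: x_def field_simps)
  have inv_sq: "((\<lambda>h. a / (u h)\<^sup>2) has_real_derivative - (2 * a * u' / (u h) ^ 3)) (at h)"
    if "(u has_real_derivative u') (at h)" "u h \<noteq> 0" for u u' and a :: real
    using that by (auto intro!: derivative_eq_intros simp: field_simps eval_nat_numeral)
  have d1: "((\<lambda>h. (1 + ?d / h)\<^sup>2) has_real_derivative - (2 / h ^ 3) * (?d * (h + ?d))) (at h)"
    using h by (auto intro!: derivative_eq_intros simp: field_simps eval_nat_numeral)
  have d2: "((\<lambda>h. coeffA \<alpha> / (h * sin (t / (2 * h)))\<^sup>2) has_real_derivative
      - (2 / h ^ 3) * (coeffA \<alpha> * ((1 - x * cot x) / (sin x)\<^sup>2))) (at h)"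
    by (rule DERIV_cong[OF inv_sq[OF ds]], unfold x_def[symmetric])
       (use h s in \<open>simp_all add: cot_def field_simps eval_nat_numeral\<close>)
  have d3: "((\<lambda>h. coeffB \<beta> / (h * cos (t / (2 * h)))\<^sup>2) has_real_derivative
      - (2 / h ^ 3) * (coeffB \<beta> * ((1 + x * tan x) / (cos x)\<^sup>2))) (at h)"
    by (rule DERIV_cong[OF inv_sq[OF dc]], unfold x_def[symmetric])
       (use h c in \<open>simp_all add: tan_def field_simps eval_nat_numeral\<close>)
  show ?thesis
    unfolding Q_def \<Phi>_def x_def[symmetric] power_mult_distrib[symmetric]
    by (rule DERIV_cong[OF DERIV_add[OF DERIV_add[OF d1 d2] d3]]) (simp only: distrib_left add.assoc)
qed

text \<open>
  The point of substituting \<open>t = 2hx\<close> is that the constraint \<open>0 < t < h\<pi>\<close>, which couples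
  \<open>t\<close> and \<open>h\<close>, becomes a product domain. The factor \<open>s\<close> lets one statement serve both monotonicity
  directions, through the instances \<open>s = 1\<close> and \<open>s = -1\<close>.
\<close>

lemma deriv_Q_sign_iff:
  assumes h0: "h\<^sub>0 > 0"
  shows "(\<forall>h t. h \<ge> h\<^sub>0 \<and> 0 < t \<and> t < h * pi \<longrightarrow> s * deriv (\<lambda>h. Q \<alpha> \<beta> \<sigma> h t) h \<le> 0) \<longleftrightarrow>
         (\<forall>h\<ge>h\<^sub>0. \<forall>x\<in>{0<..<pi/2}.
            0 \<le> s * (delta \<alpha> \<beta> \<sigma>) * (h + delta \<alpha> \<beta> \<sigma>) + s * \<Phi> \<alpha> \<beta> x)"
    (is "?L \<longleftrightarrow> ?R")
proof -
  have sign: "s * deriv (\<lambda>h. Q \<alpha> \<beta> \<sigma> h t) h \<le> 0 \<longleftrightarrow>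
      0 \<le> s * (delta \<alpha> \<beta> \<sigma>) * (h + delta \<alpha> \<beta> \<sigma>) + s * \<Phi> \<alpha> \<beta> (t / (2 * h))"
    if "h \<ge> h\<^sub>0" "0 < t" "t < h * pi" for h t
  proof -
    have h: "h > 0" using that h0 by simp
    have "s * deriv (\<lambda>h. Q \<alpha> \<beta> \<sigma> h t) h = - (2 / h ^ 3) *
        (s * (delta \<alpha> \<beta> \<sigma>) * (h + delta \<alpha> \<beta> \<sigma>) + s * \<Phi> \<alpha> \<beta> (t / (2 * h)))"
      by (subst DERIV_imp_deriv[OF Q_has_derivative[OF h that(2,3)]]) (simp add: algebra_simps)
    moreover have "- p * w \<le> 0 \<longleftrightarrow> 0 \<le> w" if "p > 0" for p w :: real
      using that by (simp add: zero_le_mult_iff)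
    moreover have "2 / h ^ 3 > 0" using h by simp
    ultimately show ?thesis by presburger
  qed
  show ?thesis
  proof
    assume L: ?L
    show ?R
    proof (intro allI impI ballI)
      fix h x :: real assume hx: "h \<ge> h\<^sub>0" "x \<in> {0<..<pi/2}"
      then have "h > 0" using h0 by simp
      then have t: "0 < 2 * h * x" "2 * h * x < h * pi" "2 * h * x / (2 * h) = x"
        using hx by auto
      show "0 \<le> s * (delta \<alpha> \<beta> \<sigma>) * (h + delta \<alpha> \<beta> \<sigma>) + s * \<Phi> \<alpha> \<beta> x"
        using sign[OF hx(1) t(1,2)] L hx t by auto
    qed
  next
    assume R: ?R
    show ?L
    proof (intro allI impI, elim conjE)
      fix h t assume ht: "h \<ge> h\<^sub>0" "0 < t" "t < h * pi"
      then have "t / (2 * h) \<in> {0<..<pi/2}"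
        using h0 by (auto simp: field_simps)
      then show "s * deriv (\<lambda>h. Q \<alpha> \<beta> \<sigma> h t) h \<le> 0"
        using sign[OF ht] R ht by blast
    qed
  qed
qed

section \<open>Sign conditions affine in the scale\<close>

text \<open>
  Letting \<open>h \<rightarrow> \<infinity>\<close> forces the slope \<open>d\<close> to be nonnegative, and for such a slope the
  endpoint \<open>h\<^sub>0\<close> is the most restrictive value of \<open>h\<close>. The two requirements
  \<open>0 \<le> d\<close> and \<open>- inf f \<le> d (h\<^sub>0 + e)\<close> combine into one by means of the positive part.
\<close>

lemma affine_plus_nonneg_iff:
  fixes f :: "'a \<Rightarrow> real"
  assumes X: "X \<noteq> {}" and bdd: "bdd_below (f ` X)" and pos: "h\<^sub>0 + e > 0"
  shows "(\<forall>h\<ge>h\<^sub>0. \<forall>x\<in>X. 0 \<le> d * (h + e) + f x) \<longleftrightarrow>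
         max (- (INF x\<in>X. f x)) 0 / (h\<^sub>0 + e) \<le> d" (is "?L \<longleftrightarrow> ?R")
proof -
  have R: "?R \<longleftrightarrow> 0 \<le> d \<and> - (INF x\<in>X. f x) \<le> d * (h\<^sub>0 + e)"
    using pos by (auto simp: pos_divide_le_eq zero_le_mult_iff)
  have inf: "- (INF x\<in>X. f x) \<le> d * (h\<^sub>0 + e) \<longleftrightarrow> (\<forall>x\<in>X. 0 \<le> d * (h\<^sub>0 + e) + f x)"
    using le_cINF_iff[OF X bdd, of "- (d * (h\<^sub>0 + e))"] by (force simp: algebra_simps)
  have slope: "0 \<le> d" if L: ?L
  proof (rule ccontr)
    assume "\<not> 0 \<le> d"
    then have d: "d < 0" by simp
    obtain x where x: "x \<in> X" using X by blast
    \<comment> \<open>At this \<open>h\<close> the affine part is at most \<open>d - \<bar>f x\<bar>\<close>.\<close>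
    define h where "h = h\<^sub>0 + (1 + \<bar>f x\<bar> / - d)"
    have "h \<ge> h\<^sub>0" using d by (simp add: h_def divide_nonneg_neg)
    then have "0 \<le> d * (h + e) + f x" using L x by blast
    moreover have "d * (h + e) = d * (h\<^sub>0 + e) + d - \<bar>f x\<bar>"
      using d by (simp add: h_def field_simps)
    moreover have "d * (h\<^sub>0 + e) < 0" using d pos by (simp add: mult_neg_pos)
    ultimately show False using d by linarith
  qed
  show ?thesis
    unfolding R inf
  proof (intro iffI conjI)
    assume "0 \<le> d \<and> (\<forall>x\<in>X. 0 \<le> d * (h\<^sub>0 + e) + f x)"
    moreover from this have "d * (h\<^sub>0 + e) \<le> d * (h + e)" if "h \<ge> h\<^sub>0" for h
      using that by (intro mult_left_mono) auto
    ultimately show ?L by (meson add_right_mono order_trans)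
  qed (use slope in auto)
qed

lemma affine_plus_nonpos_iff:
  fixes f :: "'a \<Rightarrow> real"
  assumes X: "X \<noteq> {}" and bdd: "bdd_above (f ` X)" and pos: "h\<^sub>0 + e > 0"
  shows "(\<forall>h\<ge>h\<^sub>0. \<forall>x\<in>X. 0 \<le> - d * (h + e) + - f x) \<longleftrightarrow>
         max (SUP x\<in>X. f x) 0 / (h\<^sub>0 + e) \<le> - d"
proof -
  have "bdd_below ((\<lambda>x. - f x) ` X)"
    using bdd by (auto simp: bdd_above_def bdd_below_def) (metis neg_le_iff_le)
  moreover have "- (INF x\<in>X. - f x) = (SUP x\<in>X. f x)"
    by (simp add: Inf_real_def image_image)
  ultimately show ?thesis
    using affine_plus_nonneg_iff[OF X _ pos, of "\<lambda>x. - f x" "- d"] by simp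
qed

section \<open>Divergence at the right endpoint\<close>

lemma tan_term_unbounded:
  "\<exists>x\<in>{0<..<pi/2}. K \<le> (1 + x * tan x) / (cos x)\<^sup>2"
proof -
  define c where "c = 1 / sqrt (\<bar>K\<bar> + 2)"
  have c: "0 < c" "c < 1" and cK: "1 / c\<^sup>2 = \<bar>K\<bar> + 2"
    by (auto simp: c_def power_divide real_less_rsqrt)
  define x where "x = arccos c"
  have cos: "cos x = c" using c by (simp add: x_def)
  have x: "0 < x" "x < pi / 2"
    using c arccos_lt_bounded[of c] arccos_less_arccos[of 0 c] by (auto simp: x_def)
  have "1 / c\<^sup>2 \<le> (1 + x * tan x) / (cos x)\<^sup>2"
    unfolding cos using x tan_gt_zero[of x] by (intro divide_right_mono) auto
  then show ?thesis using x cK by (intro bexI[of _ x]) auto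
qed

text \<open>
  Since the \<open>A\<close>-term of \<open>\<Phi>\<close> is bounded, the sign of \<open>B\<close> decides the direction in which
  \<open>\<Phi>\<close> diverges; again \<open>s = 1\<close> and \<open>s = -1\<close> give the two directions.
\<close>

lemma \<Phi>_unbounded:
  assumes "s * coeffB \<beta> < 0"
  shows "\<exists>x\<in>{0<..<pi/2}. s * \<Phi> \<alpha> \<beta> x < K"
proof -
  define M where "M = \<bar>s\<bar> * (\<bar>coeffA \<alpha>\<bar> * (pi\<^sup>2 / 4))"
  define b where "b = - (s * coeffB \<beta>)"
  have b: "b > 0" using assms by (simp add: b_def)
  obtain x where x: "x \<in> {0<..<pi/2}" "(M + \<bar>K\<bar> + 1) / b \<le> (1 + x * tan x) / (cos x)\<^sup>2"
    using tan_term_unbounded by blast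
  have "M + \<bar>K\<bar> + 1 \<le> b * ((1 + x * tan x) / (cos x)\<^sup>2)"
    using x(2) b by (simp add: pos_divide_le_eq mult.commute)
  moreover have "\<bar>s * (coeffA \<alpha> * ((1 - x * cot x) / (sin x)\<^sup>2))\<bar> \<le> M"
    unfolding M_def abs_mult[of s] using x coeffA_term_bound[of x \<alpha>]
    by (intro mult_left_mono) auto
  ultimately have "s * \<Phi> \<alpha> \<beta> x < K"
    unfolding \<Phi>_def b_def distrib_left mult_minus_left mult.assoc by linarith
  then show ?thesis using x by blast
qed

section \<open>Constancy in the scale\<close>

lemma entire_zero_on_interval:
  fixes g :: "complex \<Rightarrow> complex"
  assumes g: "g holomorphic_on UNIV" and ab: "a < b"
    and zero: "\<And>x. a < x \<Longrightarrow> x < b \<Longrightarrow> g (of_real x) = 0"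
  shows "g z = 0"
proof -
  define m where "m = (a + b) / 2"
  have m: "a < m" "m < b" using ab by (auto simp: m_def)
  have "m islimpt {a<..<b}"
    using m by (intro interior_limit_point) simp
  then have "complex_of_real m islimpt of_real ` {a<..<b}"
    by (simp add: islimpt_approachable dist_of_real)
  then show ?thesis
    by (rule analytic_continuation[OF g open_UNIV connected_UNIV subset_UNIV UNIV_I])
       (use zero in auto)
qed

text \<open>
  Multiplying \<open>Q = C\<close> by \<open>sin\<^sup>2 x cos\<^sup>2 x\<close>, with \<open>1/h = 2x/t\<close>, removes the poles; the
  resulting identity survives analytic continuation, so it may be evaluated at the poles
  \<open>x = \<pi>/2\<close> and \<open>x = \<pi>\<close> of \<open>Q\<close>.
\<close>

lemma cleared_equation_imp_coefficients_zero:
  fixes A B C k d a b :: real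
  assumes k: "k > 0" and ab: "a < b"
    and eq: "\<And>x. a < x \<Longrightarrow> x < b \<Longrightarrow>
      ((1 + d * (k * x))\<^sup>2 - C) * (sin x)\<^sup>2 * (cos x)\<^sup>2
        + (k * x)\<^sup>2 * (A * (cos x)\<^sup>2 + B * (sin x)\<^sup>2) = 0"
  shows "A = 0" "B = 0" "d = 0"
proof -
  define g :: "complex \<Rightarrow> complex" where
    "g z = ((1 + of_real d * (of_real k * z))\<^sup>2 - of_real C) * (sin z)\<^sup>2 * (cos z)\<^sup>2
        + (of_real k * z)\<^sup>2 * (of_real A * (cos z)\<^sup>2 + of_real B * (sin z)\<^sup>2)" for z
  have g_real: "g (of_real x) = of_real
      (((1 + d * (k * x))\<^sup>2 - C) * (sin x)\<^sup>2 * (cos x)\<^sup>2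
        + (k * x)\<^sup>2 * (A * (cos x)\<^sup>2 + B * (sin x)\<^sup>2))" for x
    by (simp add: g_def sin_of_real cos_of_real)
  have "g holomorphic_on UNIV"
    unfolding g_def by (intro holomorphic_intros)
  then have "g z = 0" for z
    by (rule entire_zero_on_interval[OF _ ab]) (simp only: g_real eq of_real_0)
  then have all: "((1 + d * (k * x))\<^sup>2 - C) * (sin x)\<^sup>2 * (cos x)\<^sup>2
        + (k * x)\<^sup>2 * (A * (cos x)\<^sup>2 + B * (sin x)\<^sup>2) = 0" for x
    using g_real[of x] by (metis of_real_eq_0_iff)
  show B: "B = 0" using all[of "pi / 2"] k by simp
  show A: "A = 0" using all[of pi] k by simp
  have quad: "(1 + d * (k * x))\<^sup>2 = C" if "sin x \<noteq> 0" "cos x \<noteq> 0" for x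
    using all[of x] A B that by simp
  \<comment> \<open>Opposite points isolate the linear term of the quadratic.\<close>
  have "(1 + d * (k * (pi / 6)))\<^sup>2 = (1 + d * (k * (- (pi / 6))))\<^sup>2"
    using quad[of "pi / 6"] quad[of "- (pi / 6)"] by (simp add: sin_30 cos_30)
  then have "d * (k * pi) = 0" by (simp add: power2_eq_square algebra_simps)
  then show "d = 0" using k by simp
qed

lemma Q_constant_imp_coefficients_zero:
  assumes t: "t > 0" and ab: "0 < a" "a < b" "t < a * pi"
    and const: "\<And>h. a \<le> h \<Longrightarrow> h \<le> b \<Longrightarrow> Q \<alpha> \<beta> \<sigma> h t = C"
  shows "coeffA \<alpha> = 0 \<and> coeffB \<beta> = 0 \<and> \<sigma> = rho \<alpha> \<beta>"
proof -
  let ?d = "delta \<alpha> \<beta> \<sigma>"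
  have range: "t / (2 * b) < t / (2 * a)" using t ab by (intro divide_strict_left_mono) auto
  have eq: "((1 + ?d * (2 / t * x))\<^sup>2 - C) * (sin x)\<^sup>2 * (cos x)\<^sup>2
        + (2 / t * x)\<^sup>2 * (coeffA \<alpha> * (cos x)\<^sup>2 + coeffB \<beta> * (sin x)\<^sup>2) = 0"
    if x: "t / (2 * b) < x" "x < t / (2 * a)" for x
  proof -
    have b: "b > 0" using ab by simp
    have x0: "x > 0" using x(1) t b by (smt (verit) divide_pos_pos)
    have "t / (2 * a) < pi / 2" using ab by (simp add: field_simps)
    then have x1: "x < pi / 2" using x by simp
    define h where "h = t / (2 * x)"
    have h: "h > 0" "a \<le> h" "h \<le> b" and tx: "t / (2 * h) = x" and kx: "2 / t * x = 1 / h"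
      using x x0 t ab b by (auto simp: h_def field_simps)
    have s: "sin x \<noteq> 0" using x0 x1 sin_gt_zero[of x] by simp
    have c: "cos x \<noteq> 0" using x0 x1 cos_gt_zero[of x] by simp
    have "C = (1 + ?d / h)\<^sup>2 + coeffA \<alpha> / (h\<^sup>2 * (sin x)\<^sup>2) + coeffB \<beta> / (h\<^sup>2 * (cos x)\<^sup>2)"
      using const[OF h(2,3)] by (simp add: Q_def tx)
    then have C: "(1 + ?d * (1 / h))\<^sup>2 - C =
        - (coeffA \<alpha> / (h\<^sup>2 * (sin x)\<^sup>2) + coeffB \<beta> / (h\<^sup>2 * (cos x)\<^sup>2))"
      by simp
    show ?thesis
      unfolding kx C using h(1) s c by (simp add: divide_simps)
  qed
  have k: "2 / t > 0" using t by simp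
  show ?thesis
    using cleared_equation_imp_coefficients_zero[OF k range eq] by (simp add: delta_def)
qed

section \<open>Monotonicity thresholds and rigidity\<close>

theorem proposition4p4:
  fixes \<alpha> \<beta> \<sigma> :: real
  assumes "\<alpha> > -1" and "\<beta> > -1" and "\<sigma> > -1"
  shows
    "((\<bar>\<beta>\<bar> > 1/2 \<longrightarrow>
         \<not> (\<forall>h t. h \<ge> 1 + \<sigma> \<and> 0 < t \<and> t < h * pi \<longrightarrow> deriv (\<lambda>h. Q \<alpha> \<beta> \<sigma> h t) h \<le> 0)) \<and>
      (\<bar>\<beta>\<bar> \<le> 1/2 \<longrightarrow>
         ((\<forall>h t. h \<ge> 1 + \<sigma> \<and> 0 < t \<and> t < h * pi \<longrightarrow> deriv (\<lambda>h. Q \<alpha> \<beta> \<sigma> h t) h \<le> 0)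
            \<longleftrightarrow> \<sigma> \<le> sigma_up \<alpha> \<beta>))) \<and>
     ((\<bar>\<beta>\<bar> < 1/2 \<longrightarrow>
         \<not> (\<forall>h t. h \<ge> 1 + \<sigma> \<and> 0 < t \<and> t < h * pi \<longrightarrow> deriv (\<lambda>h. Q \<alpha> \<beta> \<sigma> h t) h \<ge> 0)) \<and>
      (\<bar>\<beta>\<bar> \<ge> 1/2 \<longrightarrow>
         ((\<forall>h t. h \<ge> 1 + \<sigma> \<and> 0 < t \<and> t < h * pi \<longrightarrow> deriv (\<lambda>h. Q \<alpha> \<beta> \<sigma> h t) h \<ge> 0)
            \<longleftrightarrow> \<sigma> \<ge> sigma_down \<alpha> \<beta>))) \<and>
     (\<forall>t>0.
        (\<exists>I. is_interval I \<and> (\<exists>a\<in>I. \<exists>b\<in>I. a < b) \<and> I \<subseteq> {h. h > 0 \<and> t < h * pi} \<and>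
             (\<lambda>h. Q \<alpha> \<beta> \<sigma> h t) constant_on I)
        \<longleftrightarrow> coeffA \<alpha> = 0 \<and> coeffB \<beta> = 0 \<and> \<sigma> = rho \<alpha> \<beta>)"
proof -
  have h0: "1 + \<sigma> > 0" using assms by simp
  have shift: "1 + \<sigma> + delta \<alpha> \<beta> \<sigma> = 1 + rho \<alpha> \<beta>" by (simp add: delta_def)
  have pos: "1 + \<sigma> + delta \<alpha> \<beta> \<sigma> > 0" unfolding shift using assms by (simp add: rho_def field_simps)
  have nonpos: "(\<forall>h t. h \<ge> 1 + \<sigma> \<and> 0 < t \<and> t < h * pi \<longrightarrow> deriv (\<lambda>h. Q \<alpha> \<beta> \<sigma> h t) h \<le> 0)
      \<longleftrightarrow> (\<forall>h\<ge>1 + \<sigma>. \<forall>x\<in>{0<..<pi/2}. 0 \<le> delta \<alpha> \<beta> \<sigma> * (h + delta \<alpha> \<beta> \<sigma>) + \<Phi> \<alpha> \<beta> x)"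
    using deriv_Q_sign_iff[OF h0, of 1] by (simp only: mult_1)
  have nonneg: "(\<forall>h t. h \<ge> 1 + \<sigma> \<and> 0 < t \<and> t < h * pi \<longrightarrow> deriv (\<lambda>h. Q \<alpha> \<beta> \<sigma> h t) h \<ge> 0)
      \<longleftrightarrow> (\<forall>h\<ge>1 + \<sigma>. \<forall>x\<in>{0<..<pi/2}. 0 \<le> - delta \<alpha> \<beta> \<sigma> * (h + delta \<alpha> \<beta> \<sigma>) + - \<Phi> \<alpha> \<beta> x)"
    using deriv_Q_sign_iff[OF h0, of "-1"]
    by (simp only: mult_minus1 neg_le_0_iff_le)
  have ne: "{0<..<pi/2} \<noteq> {}" by (simp add: not_le)
  \<comment> \<open>At the endpoint \<open>h = 1 + \<sigma>\<close> the divergence of \<open>\<Phi>\<close> beats the constant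
      \<open>\<delta> (1 + \<rho>)\<close>.\<close>
  have up: "\<not> (\<forall>h t. h \<ge> 1 + \<sigma> \<and> 0 < t \<and> t < h * pi \<longrightarrow> deriv (\<lambda>h. Q \<alpha> \<beta> \<sigma> h t) h \<le> 0)"
    if "\<bar>\<beta>\<bar> > 1/2"
  proof -
    have "1 * coeffB \<beta> < 0" using that coeffB_nonneg_iff[of \<beta>] by simp
    from \<Phi>_unbounded[OF this] obtain x where x: "x \<in> {0<..<pi/2}"
      "1 * \<Phi> \<alpha> \<beta> x < - (delta \<alpha> \<beta> \<sigma> * (1 + \<sigma> + delta \<alpha> \<beta> \<sigma>))" by blast
    have "\<not> 0 \<le> delta \<alpha> \<beta> \<sigma> * (1 + \<sigma> + delta \<alpha> \<beta> \<sigma>) + \<Phi> \<alpha> \<beta> x"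
      using x(2) by linarith
    then show ?thesis
      unfolding nonpos using x(1) by blast
  qed
  have down: "\<not> (\<forall>h t. h \<ge> 1 + \<sigma> \<and> 0 < t \<and> t < h * pi \<longrightarrow> deriv (\<lambda>h. Q \<alpha> \<beta> \<sigma> h t) h \<ge> 0)"
    if "\<bar>\<beta>\<bar> < 1/2"
  proof -
    have "-1 * coeffB \<beta> < 0" using that coeffB_nonpos_iff[of \<beta>] by simp
    from \<Phi>_unbounded[OF this] obtain x where x: "x \<in> {0<..<pi/2}"
      "-1 * \<Phi> \<alpha> \<beta> x < delta \<alpha> \<beta> \<sigma> * (1 + \<sigma> + delta \<alpha> \<beta> \<sigma>)" by blast
    have "\<not> 0 \<le> - delta \<alpha> \<beta> \<sigma> * (1 + \<sigma> + delta \<alpha> \<beta> \<sigma>) + - \<Phi> \<alpha> \<beta> x"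
      using x(2) by linarith
    then show ?thesis
      unfolding nonneg using x(1) by blast
  qed
  have up_iff: "(\<forall>h t. h \<ge> 1 + \<sigma> \<and> 0 < t \<and> t < h * pi \<longrightarrow> deriv (\<lambda>h. Q \<alpha> \<beta> \<sigma> h t) h \<le> 0)
      \<longleftrightarrow> \<sigma> \<le> sigma_up \<alpha> \<beta>" if "\<bar>\<beta>\<bar> \<le> 1/2"
    unfolding nonpos affine_plus_nonneg_iff[OF ne bdd_below_\<Phi>[OF that] pos] shift
    by (auto simp: sigma_up_def \<Phi>_inf_def delta_def)
  have down_iff: "(\<forall>h t. h \<ge> 1 + \<sigma> \<and> 0 < t \<and> t < h * pi \<longrightarrow> deriv (\<lambda>h. Q \<alpha> \<beta> \<sigma> h t) h \<ge> 0)
      \<longleftrightarrow> \<sigma> \<ge> sigma_down \<alpha> \<beta>" if "\<bar>\<beta>\<bar> \<ge> 1/2"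
    unfolding nonneg affine_plus_nonpos_iff[OF ne bdd_above_\<Phi>[OF that] pos] shift
    by (auto simp: sigma_down_def \<Phi>_sup_def delta_def)
  have const: "(\<exists>I. is_interval I \<and> (\<exists>a\<in>I. \<exists>b\<in>I. a < b) \<and> I \<subseteq> {h. h > 0 \<and> t < h * pi} \<and>
             (\<lambda>h. Q \<alpha> \<beta> \<sigma> h t) constant_on I)
        \<longleftrightarrow> coeffA \<alpha> = 0 \<and> coeffB \<beta> = 0 \<and> \<sigma> = rho \<alpha> \<beta>" (is "?L \<longleftrightarrow> ?R") if t: "t > 0" for t
  proof
    assume ?L
    then obtain I a b C where I: "is_interval I" "a \<in> I" "b \<in> I" "a < b"
        "I \<subseteq> {h. h > 0 \<and> t < h * pi}" "\<And>h. h \<in> I \<Longrightarrow> Q \<alpha> \<beta> \<sigma> h t = C"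
      unfolding constant_on_def by blast
    then have "Q \<alpha> \<beta> \<sigma> h t = C" if "a \<le> h" "h \<le> b" for h
      using that by (metis mem_is_interval_1_I)
    with I t show ?R
      by (intro Q_constant_imp_coefficients_zero[of t a b]) auto
  next
    assume R: ?R
    let ?I = "{t / pi + 1 .. t / pi + 2}"
    have "h > 0 \<and> t < h * pi" if "h \<in> ?I" for h
    proof -
      have "t / pi < h" using that by simp
      moreover from this have "t < h * pi" by (simp add: pos_divide_less_eq)
      moreover have "0 < t / pi" using t by simp
      ultimately show ?thesis by linarith
    qed
    moreover have "(\<lambda>h. Q \<alpha> \<beta> \<sigma> h t) constant_on ?I"
      using R by (auto simp: constant_on_def Q_def delta_def)
    moreover have "\<exists>a\<in>?I. \<exists>b\<in>?I. a < b"
      by (intro bexI[of _ "t / pi + 1"] bexI[of _ "t / pi + 2"]) auto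
    ultimately show ?L
      by (intro exI[of _ ?I]) (auto simp: is_interval_cc)
  qed
  show ?thesis
    using up up_iff down down_iff const by blast
qed

end
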